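(* Let $\mathcal{A}(A)$ be a quasiclosed ring of mappings of an $\Omega$-algebra $A$. Let $$a^i_1\circ x^1+\dots+a^i_n\circ x^n=b^i,\qquad i=1,\dots,n,$$ be a nonsingular system of additive equations, where $a=(a^i_j)$ is a matrix of $\mathcal{A}(A)$-mappings. Then the solution of this system is determined uniquely and can be presented in either form $$x=a^{-1}\,{}_\circ{}^\circ\, b,$$ $$x=\mathcal{H}\det(a)\,{}_\circ{}^\circ\, b.$$
   Context: $A$ is an $\Omega$-algebra (universal algebra) in which an operation of addition is defined, and $A$ is a commutative group with respect to addition. $\mathcal{A}(A)$ is a set of mappings $A\to A$ that are homomorphisms of this additive group; it is closed under addition $(f+g)\circ x=f\circ x+g\circ x$ and composition $\circ$, and so is a ring; here $f\circ x=f(x)$. Elements of $\mathcal{A}(A)$ are called $\mathcal{A}(A)$-mappings. The ring $\mathcal{A}(A)$ is quasiclosed if, whenever $f\in\mathcal{A}(A)$ has an inverse mapping $f^{-1}$, then $f^{-1}\in\mathcal{A}(A)$. In matrices the upper index numbers rows and the lower index numbers columns. The ${}_\circ{}^\circ$-product of matrices is $(b\,{}_\circ{}^\circ\, c)^i_j=\sum_k b^i_k\circ c^k_j$, and likewise for a matrix of mappings times a column of elements of $A$. In the system, $x=(x^1,\dots,x^n)$ is the column of unknowns in $A$ and $b=(b^1,\dots,b^n)$ is a column of elements of $A$, so the system reads $a\,{}_\circ{}^\circ\, x=b$. The ${}_\circ{}^\circ$-inverse matrix $a^{-1}$ of an $n\times n$ matrix $a$ of $\mathcal{A}(A)$-mappings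 is defined by $a\,{}_\circ{}^\circ\, a^{-1}=\delta$, where $\delta$ is the identity matrix (identity mappings on the diagonal, zero mappings elsewhere). The matrix $a$ is called nonsingular if it has a ${}_\circ{}^\circ$-inverse matrix, and the system is called nonsingular if its matrix $a$ is nonsingular. $\mathcal{H}$ denotes the Hadamard inverse: $(\mathcal{H}c)^j_i=(c^i_j)^{-1}$ (with transposition of indices). The quasideterminant $\det(a)$ (with respect to the ${}_\circ{}^\circ$-product) is the matrix of formal expressions $\det(a)^j_i=(\mathcal{H}a^{-1})^j_i$.
   Formalization: The inverse matrix is required to be two-sided (also a⁻¹∘a = δ); with only a∘a⁻¹ = δ uniqueness fails, e.g. n = 1, a the left shift on finitely supported integer sequences with the right shift as right inverse. *)

theory Defs
  imports "HOL-Analysis.Finite_Cartesian_Product"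
begin

text \<open>
  The underlying set of the \<open>\<Omega>\<close>-algebra is the type \<^typ>\<open>'a\<close>; an operation symbol
  \<open>\<omega> \<in> \<Omega>\<close> is interpreted by \<open>oper \<omega>\<close>, applied to lists of length \<open>arity \<omega>\<close>. The group
  axioms for the addition are those of the class \<^class>\<open>ab_group_add\<close>.
\<close>

definition omega_algebra_with_addition ::
  "'o set \<Rightarrow> ('o \<Rightarrow> nat) \<Rightarrow> ('o \<Rightarrow> 'a::ab_group_add list \<Rightarrow> 'a) \<Rightarrow> bool" where
  "omega_algebra_with_addition \<Omega> arity oper \<longleftrightarrow>
     (\<exists>p\<in>\<Omega>. arity p = 2 \<and> (\<forall>x y. oper p [x, y] = x + y))"

text \<open>
  No identity element is demanded of the ring: the equations for an inverse matrix force the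
  identity mapping to belong to it anyway.
\<close>

definition mapping_ring :: "('a::ab_group_add \<Rightarrow> 'a) set \<Rightarrow> bool" where
  "mapping_ring R \<longleftrightarrow>
     (\<forall>f\<in>R. additive f) \<and>
     (\<lambda>x. 0) \<in> R \<and>
     (\<forall>f\<in>R. (\<lambda>x. - f x) \<in> R) \<and>
     (\<forall>f\<in>R. \<forall>g\<in>R. (\<lambda>x. f x + g x) \<in> R) \<and>
     (\<forall>f\<in>R. \<forall>g\<in>R. f \<circ> g \<in> R)"

definition quasiclosed :: "('a \<Rightarrow> 'a) set \<Rightarrow> bool" where
  "quasiclosed R \<longleftrightarrow> (\<forall>f\<in>R. bij f \<longrightarrow> inv f \<in> R)"

text \<open>In \<open>a $ i $ j\<close> the row index is \<open>i\<close> and the column index is \<open>j\<close>.\<close>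

definition matrix_over :: "('a \<Rightarrow> 'a) set \<Rightarrow> ('a \<Rightarrow> 'a)^'n^'m \<Rightarrow> bool" where
  "matrix_over R a \<longleftrightarrow> (\<forall>i j. a $ i $ j \<in> R)"

definition circ_mult ::
  "('a::ab_group_add \<Rightarrow> 'a)^'n^'m \<Rightarrow> ('a \<Rightarrow> 'a)^'k^'n \<Rightarrow> ('a \<Rightarrow> 'a)^'k^'m" where
  "circ_mult b c = (\<chi> i j. (\<lambda>x. \<Sum>k\<in>UNIV. (b $ i $ k \<circ> c $ k $ j) x))"

definition circ_apply :: "('a::ab_group_add \<Rightarrow> 'a)^'n^'m \<Rightarrow> 'a^'n \<Rightarrow> 'a^'m" where
  "circ_apply a x = (\<chi> i. \<Sum>j\<in>UNIV. (a $ i $ j) (x $ j))"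

definition circ_delta :: "('a::ab_group_add \<Rightarrow> 'a)^'n^'n" where
  "circ_delta = (\<chi> i j. if i = j then id else (\<lambda>x. 0))"

text \<open>
  Inverse matrices are two-sided. With \<open>a c = \<delta>\<close> alone a solution of \<open>a x = b\<close> need not be unique
  (left shift on finitely supported integer sequences). If that single equation is to determine
  \<open>c\<close>, then \<open>c\<close> is two-sided; see \<open>is_circ_inverse_iff\<close> below.
\<close>

definition is_circ_inverse ::
  "('a::ab_group_add \<Rightarrow> 'a) set \<Rightarrow> ('a \<Rightarrow> 'a)^'n^'n \<Rightarrow> ('a \<Rightarrow> 'a)^'n^'n \<Rightarrow> bool" where
  "is_circ_inverse R a c \<longleftrightarrow>
     matrix_over R c \<and> circ_mult a c = circ_delta \<and> circ_mult c a = circ_delta"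

definition nonsingular :: "('a::ab_group_add \<Rightarrow> 'a) set \<Rightarrow> ('a \<Rightarrow> 'a)^'n^'n \<Rightarrow> bool" where
  "nonsingular R a \<longleftrightarrow> (\<exists>c. is_circ_inverse R a c)"

definition circ_inverse ::
  "('a::ab_group_add \<Rightarrow> 'a) set \<Rightarrow> ('a \<Rightarrow> 'a)^'n^'n \<Rightarrow> ('a \<Rightarrow> 'a)^'n^'n" where
  "circ_inverse R a = (THE c. is_circ_inverse R a c)"

text \<open>
  The entries of an inverse matrix need not be bijective, so the entries of its Hadamard inverse
  are formal. An expression denotes a relation, \<open>Inverse\<close> being the converse; it stands for a
  mapping if that relation is the graph of the mapping. For mappings the formal inverse stands
  for a mapping exactly when the genuine inverse exists; see \<open>denotes_Inverse_iff\<close> below.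
\<close>

datatype 'a mapping_expr = Mapping "'a \<Rightarrow> 'a" | Inverse "'a mapping_expr"

primrec denotation :: "'a mapping_expr \<Rightarrow> ('a \<times> 'a) set" where
  "denotation (Mapping f) = {(x, f x) | x. True}"
| "denotation (Inverse e) = (denotation e)\<inverse>"

definition denotes :: "'a mapping_expr \<Rightarrow> ('a \<Rightarrow> 'a) \<Rightarrow> bool" where
  "denotes e f \<longleftrightarrow> denotation e = {(x, f x) | x. True}"

definition denotes_matrix :: "'a mapping_expr^'n^'m \<Rightarrow> ('a \<Rightarrow> 'a)^'n^'m \<Rightarrow> bool" where
  "denotes_matrix e h \<longleftrightarrow> (\<forall>i j. denotes (e $ i $ j) (h $ i $ j))"

definition hadamard_inverse :: "'a mapping_expr^'n^'m \<Rightarrow> 'a mapping_expr^'m^'n" where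
  "hadamard_inverse c = (\<chi> j i. Inverse (c $ i $ j))"

definition quasidet ::
  "('a::ab_group_add \<Rightarrow> 'a) set \<Rightarrow> ('a \<Rightarrow> 'a)^'n^'n \<Rightarrow> 'a mapping_expr^'n^'n" where
  "quasidet R a = hadamard_inverse (\<chi> i j. Mapping (circ_inverse R a $ i $ j))"

lemma denotes_unique:
  assumes "denotes e f" "denotes e g"
  shows "f = g"
proof
  fix x
  have "(x, f x) \<in> {(x, g x) | x. True}"
    using assms unfolding denotes_def by blast
  then show "f x = g x" by simp
qed

lemma denotes_Inverse_iff:
  assumes "denotes e f"
  shows "denotes (Inverse e) g \<longleftrightarrow> bij f \<and> g = inv f"
proof -
  have conv: "denotation (Inverse e) = {(f x, x) | x. True}"
    using assms by (auto simp: denotes_def)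
  show ?thesis
  proof
    assume "denotes (Inverse e) g"
    then have eq: "{(f x, x) | x. True} = {(x, g x) | x. True}"
      using conv by (simp add: denotes_def)
    have gf: "g (f x) = x" for x
    proof -
      have "(f x, x) \<in> {(x, g x) | x. True}" by (subst eq [symmetric]) blast
      then show ?thesis by simp
    qed
    have fg: "f (g x) = x" for x
    proof -
      have "(x, g x) \<in> {(f x, x) | x. True}" by (subst eq) blast
      then show ?thesis by simp
    qed
    have "g \<circ> f = id" "f \<circ> g = id" using gf fg by auto
    then show "bij f \<and> g = inv f"
      by (metis o_bij inv_unique_comp)
  next
    assume r: "bij f \<and> g = inv f"
    then have "y = f x \<longleftrightarrow> x = g y" for x y
      by (metis bij_inv_eq_iff)
    then show "denotes (Inverse e) g"
      unfolding denotes_def conv by blast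
  qed
qed

lemmas mapping_ring_additive = mapping_ring_def [THEN iffD1, THEN conjunct1, THEN bspec]
lemmas mapping_ring_zero = mapping_ring_def [THEN iffD1, THEN conjunct2, THEN conjunct1]
lemmas mapping_ring_minus =
  mapping_ring_def [THEN iffD1, THEN conjunct2, THEN conjunct2, THEN conjunct1, THEN bspec]
lemmas mapping_ring_add =
  mapping_ring_def [THEN iffD1, THEN conjunct2, THEN conjunct2, THEN conjunct2, THEN conjunct1, THEN bspec, THEN bspec]
lemmas mapping_ring_comp =
  mapping_ring_def [THEN iffD1, THEN conjunct2, THEN conjunct2, THEN conjunct2, THEN conjunct2, THEN bspec, THEN bspec]

lemma matrix_overD: "matrix_over R a \<Longrightarrow> a $ i $ j \<in> R"
  by (simp add: matrix_over_def)

lemma circ_mult_nth: "circ_mult b c $ i $ j = (\<lambda>x. \<Sum>k\<in>UNIV. (b $ i $ k) ((c $ k $ j) x))"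
  by (simp add: circ_mult_def)

lemma circ_mult_assoc:
  assumes "mapping_ring R" "matrix_over R b"
  shows "circ_mult (circ_mult b c) d = circ_mult b (circ_mult c d)"
proof -
  have add: "additive (b $ i $ k)" for i k
    by (rule mapping_ring_additive [OF assms(1) matrix_overD [OF assms(2)]])
  have "(\<Sum>l\<in>UNIV. \<Sum>k\<in>UNIV. (b $ i $ k) ((c $ k $ l) ((d $ l $ j) x))) =
        (\<Sum>k\<in>UNIV. (b $ i $ k) (\<Sum>l\<in>UNIV. (c $ k $ l) ((d $ l $ j) x)))" for i j x
    by (subst sum.swap) (simp add: additive.sum [OF add])
  then show ?thesis
    by (simp add: vec_eq_iff circ_mult_nth fun_eq_iff)
qed

lemma circ_mult_delta_left: "circ_mult circ_delta c = c"
proof -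
  have "(\<Sum>k\<in>UNIV. (circ_delta $ i $ k) ((c $ k $ j) x)) =
        (\<Sum>k\<in>UNIV. if k = i then (c $ k $ j) x else 0)" for i j x
    by (rule sum.cong) (auto simp: circ_delta_def)
  then show ?thesis
    by (simp add: vec_eq_iff circ_mult_nth fun_eq_iff)
qed

lemma circ_mult_delta_right:
  assumes "mapping_ring R" "matrix_over R b"
  shows "circ_mult b circ_delta = b"
proof -
  have add: "additive (b $ i $ k)" for i k
    by (rule mapping_ring_additive [OF assms(1) matrix_overD [OF assms(2)]])
  have "(\<Sum>k\<in>UNIV. (b $ i $ k) ((circ_delta $ k $ j) x)) =
        (\<Sum>k\<in>UNIV. if k = j then (b $ i $ k) x else 0)" for i j x
    by (rule sum.cong) (auto simp: circ_delta_def additive.zero [OF add])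
  then show ?thesis
    by (simp add: vec_eq_iff circ_mult_nth fun_eq_iff)
qed

lemma mapping_ring_sum:
  assumes R: "mapping_ring R" and "finite S" "\<And>k. k \<in> S \<Longrightarrow> f k \<in> R"
  shows "(\<lambda>x. \<Sum>k\<in>S. f k x) \<in> R"
  using assms(2,3)
proof (induction S rule: finite_induct)
  case empty
  show ?case using mapping_ring_zero [OF R] by simp
next
  case (insert k S)
  then have "f k \<in> R" and "(\<lambda>x. \<Sum>k\<in>S. f k x) \<in> R" by auto
  then have "(\<lambda>x. f k x + (\<Sum>k\<in>S. f k x)) \<in> R"
    by (rule mapping_ring_add [OF R])
  then show ?case using insert.hyps by simp
qed

lemma matrix_over_circ_mult:
  assumes "mapping_ring R" "matrix_over R b" "matrix_over R c"
  shows "matrix_over R (circ_mult b c)"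
proof -
  have "b $ i $ k \<circ> c $ k $ j \<in> R" for i j k
    by (intro mapping_ring_comp [OF assms(1)] matrix_overD assms(2,3))
  then show ?thesis
    unfolding matrix_over_def circ_mult_def
    by (simp del: comp_apply) (intro allI mapping_ring_sum [OF assms(1)] finite)
qed

lemma is_circ_inverse_unique:
  assumes R: "mapping_ring R" and a: "matrix_over R a"
    and c: "is_circ_inverse R a c" and d: "matrix_over R d" "circ_mult a d = circ_delta"
  shows "d = c"
proof -
  have "matrix_over R c" using c by (simp add: is_circ_inverse_def)
  then have "circ_mult (circ_mult c a) d = circ_mult c (circ_mult a d)"
    by (rule circ_mult_assoc [OF R])
  moreover have "circ_mult c a = circ_delta" using c by (simp add: is_circ_inverse_def)
  moreover have "circ_mult c circ_delta = c"
    by (rule circ_mult_delta_right [OF R \<open>matrix_over R c\<close>])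
  ultimately show ?thesis by (simp add: d circ_mult_delta_left)
qed

lemma circ_inverse_eq:
  assumes "mapping_ring R" "matrix_over R a" "is_circ_inverse R a c"
  shows "circ_inverse R a = c"
  unfolding circ_inverse_def
proof (rule the_equality)
  show "is_circ_inverse R a c" by fact
  show "d = c" if "is_circ_inverse R a d" for d
    using is_circ_inverse_unique [OF assms] that unfolding is_circ_inverse_def by blast
qed

lemma is_circ_inverse_iff:
  assumes R: "mapping_ring R" and a: "matrix_over R a"
  shows "is_circ_inverse R a c \<longleftrightarrow>
    matrix_over R c \<and> circ_mult a c = circ_delta \<and>
    (\<forall>d. matrix_over R d \<and> circ_mult a d = circ_delta \<longrightarrow> d = c)"
    (is "_ \<longleftrightarrow> ?r")
proof
  assume "is_circ_inverse R a c"
  then show ?r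
    using is_circ_inverse_unique [OF R a] unfolding is_circ_inverse_def by blast
next
  assume r: ?r
  then have c: "matrix_over R c" and ac: "circ_mult a c = circ_delta" by auto
  let ?ca = "circ_mult c a"
  define d where "d = (\<chi> i j. (\<lambda>x. (c $ i $ j) x + ((?ca $ i $ j) x + - (circ_delta $ i $ j) x)))"
  have delta: "matrix_over R (circ_delta :: ('a \<Rightarrow> 'a)^'b^'b)"
    using matrix_over_circ_mult [OF R a c] ac by simp
  have ca: "matrix_over R ?ca" by (rule matrix_over_circ_mult [OF R c a])
  have "matrix_over R d"
    unfolding matrix_over_def d_def
    by (simp only: vec_lambda_beta, intro allI mapping_ring_add [OF R] mapping_ring_minus [OF R]
        matrix_overD [OF c] matrix_overD [OF ca] matrix_overD [OF delta])
  moreover have "circ_mult a d = circ_delta"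
  proof -
    have add: "additive (a $ i $ k)" for i k
      by (rule mapping_ring_additive [OF R matrix_overD [OF a]])
    have "circ_mult a ?ca = a"
      using circ_mult_assoc [OF R a, of c a] ac by (simp add: circ_mult_delta_left)
    moreover have "circ_mult a circ_delta = a"
      by (rule circ_mult_delta_right [OF R a])
    moreover have "(circ_mult a d $ i $ j) x = (circ_mult a c $ i $ j) x +
        ((circ_mult a ?ca $ i $ j) x - (circ_mult a circ_delta $ i $ j) x)" for i j x
      unfolding circ_mult_nth [of a] d_def
      by (simp add: additive.add [OF add] additive.minus [OF add] additive.diff [OF add]
          sum.distrib sum_subtractf sum_negf)
    ultimately show ?thesis by (simp add: vec_eq_iff fun_eq_iff ac)
  qed
  ultimately have "d = c" using r by blast
  then have "?ca = circ_delta"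
    unfolding d_def by (auto simp: vec_eq_iff fun_eq_iff)
  then show "is_circ_inverse R a c"
    using c ac by (simp add: is_circ_inverse_def)
qed

end

theory Submission
  imports Defs
begin

text \<open>
  Matrices of additive mappings act on columns, and composing the actions of two matrices is the
  action of their product. Hence a two-sided inverse matrix acts as the two-sided inverse of the
  map \<open>x \<mapsto> a x\<close>, so that map is a bijection: \<open>a x = b\<close> holds exactly for \<open>x = a\<inverse> b\<close>.
  The actions are compatible because the entries of the left factor are additive; here that
  factor is \<open>a\<close> or \<open>a\<inverse>\<close>, both of which are matrices over the ring.

  The second form of the solution is the first one in disguise. The quasideterminant is the formal
  Hadamard inverse of \<open>a\<inverse>\<close>, and taking the Hadamard inverse again transposes the indices back and
  puts a double formal inverse on each entry. As a relation is the converse of its converse,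
  these entries denote the entries of \<open>a\<inverse>\<close>, even where an entry of \<open>a\<inverse>\<close> is not bijective and the
  corresponding entry of the quasideterminant denotes no mapping.
\<close>

lemma circ_apply_circ_mult:
  assumes "mapping_ring R" "matrix_over R b"
  shows "circ_apply (circ_mult b c) x = circ_apply b (circ_apply c x)"
proof -
  have add: "additive (b $ i $ k)" for i k
    by (rule mapping_ring_additive [OF assms(1) matrix_overD [OF assms(2)]])
  have "(\<Sum>j\<in>UNIV. \<Sum>k\<in>UNIV. (b $ i $ k) ((c $ k $ j) (x $ j))) =
        (\<Sum>k\<in>UNIV. (b $ i $ k) (\<Sum>j\<in>UNIV. (c $ k $ j) (x $ j)))" for i
    by (subst sum.swap) (simp add: additive.sum [OF add])
  then show ?thesis
    by (simp add: circ_apply_def circ_mult_nth)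
qed

lemma circ_apply_delta: "circ_apply circ_delta x = x"
proof -
  have "(\<Sum>j\<in>UNIV. (circ_delta $ i $ j) (x $ j)) = (\<Sum>j\<in>UNIV. if j = i then x $ j else 0)" for i
    by (rule sum.cong) (auto simp: circ_delta_def)
  then show ?thesis
    by (simp add: circ_apply_def vec_eq_iff)
qed

lemma circ_apply_eq_iff:
  assumes R: "mapping_ring R" and a: "matrix_over R a" and c: "is_circ_inverse R a c"
  shows "circ_apply a x = b \<longleftrightarrow> x = circ_apply c b"
proof -
  have cR: "matrix_over R c" and ac: "circ_mult a c = circ_delta" and ca: "circ_mult c a = circ_delta"
    using c by (simp_all add: is_circ_inverse_def)
  have "circ_apply a (circ_apply c b) = b"
    by (simp add: circ_apply_circ_mult [OF R a, symmetric] ac circ_apply_delta)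
  moreover have "circ_apply c (circ_apply a x) = x"
    by (simp add: circ_apply_circ_mult [OF R cR, symmetric] ca circ_apply_delta)
  ultimately show ?thesis by auto
qed

text \<open>
  Both transpositions cancel, and so do both formal inverses: the cancellation takes place among
  relations, where every converse exists.
\<close>

lemma denotes_hadamard_inverse_quasidet:
  "denotes_matrix (hadamard_inverse (quasidet R a)) (circ_inverse R a)"
  by (simp add: denotes_matrix_def denotes_def hadamard_inverse_def quasidet_def)

theorem theorem2p4p2:
  fixes \<Omega> :: "'o set" and arity :: "'o \<Rightarrow> nat"
    and oper :: "'o \<Rightarrow> 'a::ab_group_add list \<Rightarrow> 'a"
    and R :: "('a \<Rightarrow> 'a) set"
    and a :: "('a \<Rightarrow> 'a)^'n^'n"
    and b :: "'a^'n"
  assumes "omega_algebra_with_addition \<Omega> arity oper"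
    and "mapping_ring R"
    and "quasiclosed R"
    and "matrix_over R a"
    and "nonsingular R a"
  shows "(\<exists>!x::'a^'n. \<forall>i. (\<Sum>j\<in>UNIV. (a $ i $ j) (x $ j)) = b $ i) \<and>
    (\<forall>x::'a^'n. (\<forall>i. (\<Sum>j\<in>UNIV. (a $ i $ j) (x $ j)) = b $ i) \<longrightarrow>
       x = circ_apply (circ_inverse R a) b \<and>
       (\<exists>h. denotes_matrix (hadamard_inverse (quasidet R a)) h \<and>
            matrix_over R h \<and> x = circ_apply h b))"
proof -
  obtain c where c: "is_circ_inverse R a c"
    using assms(5) unfolding nonsingular_def by blast
  have inv: "circ_inverse R a = c"
    by (rule circ_inverse_eq [OF assms(2,4) c])
  have "matrix_over R (circ_inverse R a)"
    using c by (simp add: inv is_circ_inverse_def)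
  moreover have "(\<forall>i. (\<Sum>j\<in>UNIV. (a $ i $ j) (x $ j)) = b $ i) \<longleftrightarrow>
      x = circ_apply (circ_inverse R a) b" for x
    using circ_apply_eq_iff [OF assms(2,4) c, of x b]
    by (simp add: inv circ_apply_def vec_eq_iff)
  ultimately show ?thesis
    using denotes_hadamard_inverse_quasidet [of R a] by auto
qed

end
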